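(* Let $\mathcal M$ and $\mathcal N=\{N^{(\lambda)}:\lambda\in\mathbb R_{>0}\}$ be two quasianalytic weight matrices and assume $\sup_{k\in\mathbb N_{>0}}(n^{(\lambda)}_k)^{1/k}=+\infty$ for all $\lambda>0$ (Roumieu case) resp. $\lim_{k\to+\infty}(n^{(\lambda)}_k)^{1/k}=+\infty$ for all $\lambda>0$ (Beurling case). Then $\Lambda^r_{[\mathcal N]}\setminus j^\infty(\mathcal E^{0,r}_{\{\mathcal M\}})$ is lineable in $\Lambda^r_{[\mathcal N]}$ (and hence so is $\Lambda^r_{[\mathcal N]}\setminus j^\infty(\mathcal E^{0,r}_{(\mathcal M)})$).
   Context: For a sequence $M=(M_p)_{p\in\mathbb N}$ of positive reals write $m_p:=M_p/p!$. $M$ is a weight sequence if $1=M_0\le M_1$, $M_p^2\le M_{p-1}M_{p+1}$ for all $p\ge1$, and $\liminf_{p\to\infty}m_p^{1/p}>0$; it is quasianalytic if $\sum_{p\ge1}M_{p-1}/M_p=+\infty$. A weight matrix is a family $\mathcal M=\{M^{(\lambda)}:\lambda\in\mathbb R_{>0}\}$ of weight sequences with $M^{(\lambda)}_p\le M^{(\kappa)}_p$ for all $p$ whenever $\lambda\le\kappa$; write $n^{(\lambda)}_p:=N^{(\lambda)}_p/p!$. It is quasianalytic if every member is quasianalytic. For $U\subseteq\mathbb R^r$ open, $K\subseteq U$ compact, $h>0$: $\|f\|^M_{K,h}:=\sup_{\alpha\in\mathbb N^r,x\in K}|\partial^\alpha f(x)|/(h^{|\alpha|}M_{|\alpha|})$.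 $\mathcal E_{\{\mathcal M\}}(U)$: smooth $f$ such that for every compact $K\subseteq U$ there exist $\lambda>0$, $h>0$ with $\|f\|^{M^{(\lambda)}}_{K,h}<\infty$; $\mathcal E_{(\mathcal M)}(U)$: smooth $f$ with $\|f\|^{M^{(\lambda)}}_{K,h}<\infty$ for all compact $K$, all $\lambda>0$, all $h>0$. $\mathcal E^{0,r}_{\{\mathcal M\}}$, $\mathcal E^{0,r}_{(\mathcal M)}$ are the corresponding spaces of germs at $0\in\mathbb R^r$. For $\mathbf b=(b_\alpha)_{\alpha\in\mathbb N^r}$, a weight sequence $N$, $h>0$: $|\mathbf b|^N_h:=\sup_\alpha|b_\alpha|/(h^{|\alpha|}n_{|\alpha|})$; $\Lambda^r_{\{\mathcal N\}}:=\{\mathbf b:\exists\lambda>0\,\exists h>0,\ |\mathbf b|^{N^{(\lambda)}}_h<\infty\}$, $\Lambda^r_{(\mathcal N)}:=\{\mathbf b:\forall\lambda>0\,\forall h>0,\ |\mathbf b|^{N^{(\lambda)}}_h<\infty\}$. The Borel map is $j^\infty(f)=(\partial^\alpha f(0)/|\alpha|!)_{\alpha\in\mathbb N^r}$. $[\cdot]$ means $\{\cdot\}$ throughout or $(\cdot)$ throughout. A subset $L$ of a vector space $X$ is lineable if $L\cup\{0\}$ contains an infinite-dimensional vector subspace. *)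

theory Defs
  imports "HOL-Analysis.Analysis"
begin

text \<open>Multi-indices in N^r are functions 'n => nat on a finite index type 'n (r = CARD('n)).\<close>

definition mlen :: "('n::finite \<Rightarrow> nat) \<Rightarrow> nat" where
  "mlen \<alpha> = (\<Sum>i\<in>UNIV. \<alpha> i)"

definition weight_sequence :: "(nat \<Rightarrow> real) \<Rightarrow> bool" where
  "weight_sequence M \<longleftrightarrow>
     (\<forall>p. M p > 0) \<and> M 0 = 1 \<and> M 0 \<le> M 1 \<and>
     (\<forall>p\<ge>1. (M p)\<^sup>2 \<le> M (p - 1) * M (p + 1)) \<and>
     liminf (\<lambda>p. ereal (root p (M p / fact p))) > 0"

definition quasianalytic :: "(nat \<Rightarrow> real) \<Rightarrow> bool" where
  "quasianalytic M \<longleftrightarrow> \<not> summable (\<lambda>p. M p / M (Suc p))"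

definition weight_matrix :: "(real \<Rightarrow> nat \<Rightarrow> real) \<Rightarrow> bool" where
  "weight_matrix MM \<longleftrightarrow>
     (\<forall>l>0. weight_sequence (MM l)) \<and>
     (\<forall>l k p. 0 < l \<longrightarrow> l \<le> k \<longrightarrow> MM l p \<le> MM k p)"

definition quasianalytic_matrix :: "(real \<Rightarrow> nat \<Rightarrow> real) \<Rightarrow> bool" where
  "quasianalytic_matrix MM \<longleftrightarrow> (\<forall>l>0. quasianalytic (MM l))"

text \<open>Smooth functions on an open set U: a family D of continuous functions with D 0 = f on U
  and D (alpha + e_i) the i-th partial derivative of D alpha on U; thus D alpha is the
  classical partial derivative of f of order alpha.\<close>
definition smooth_family :: "(real^'n) set \<Rightarrow> (('n \<Rightarrow> nat) \<Rightarrow> real^'n \<Rightarrow> real) \<Rightarrow> bool" where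
  "smooth_family U D \<longleftrightarrow>
     (\<forall>\<alpha>. continuous_on U (D \<alpha>)) \<and>
     (\<forall>\<alpha> i x. x \<in> U \<longrightarrow>
        ((\<lambda>t. D \<alpha> (x + t *\<^sub>R axis i 1)) has_real_derivative D (\<alpha>(i := Suc (\<alpha> i))) x) (at 0))"

definition norm_finite :: "(nat \<Rightarrow> real) \<Rightarrow> (real^'n) set \<Rightarrow> real \<Rightarrow> (('n \<Rightarrow> nat) \<Rightarrow> real^'n \<Rightarrow> real) \<Rightarrow> bool" where
  "norm_finite M K h D \<longleftrightarrow>
     (\<exists>C. \<forall>\<alpha>. \<forall>x\<in>K. \<bar>D \<alpha> x\<bar> \<le> C * h ^ mlen \<alpha> * M (mlen \<alpha>))"

definition E_roumieu_family :: "(real \<Rightarrow> nat \<Rightarrow> real) \<Rightarrow> (real^'n) set \<Rightarrow> (('n::finite \<Rightarrow> nat) \<Rightarrow> real^'n \<Rightarrow> real) \<Rightarrow> bool" where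
  "E_roumieu_family MM U D \<longleftrightarrow> smooth_family U D \<and>
     (\<forall>K. compact K \<and> K \<subseteq> U \<longrightarrow> (\<exists>l>0. \<exists>h>0. norm_finite (MM l) K h D))"

definition E_beurling_family :: "(real \<Rightarrow> nat \<Rightarrow> real) \<Rightarrow> (real^'n) set \<Rightarrow> (('n::finite \<Rightarrow> nat) \<Rightarrow> real^'n \<Rightarrow> real) \<Rightarrow> bool" where
  "E_beurling_family MM U D \<longleftrightarrow> smooth_family U D \<and>
     (\<forall>K. compact K \<and> K \<subseteq> U \<longrightarrow> (\<forall>l>0. \<forall>h>0. norm_finite (MM l) K h D))"

definition E_roumieu :: "(real \<Rightarrow> nat \<Rightarrow> real) \<Rightarrow> (real^'n::finite) set \<Rightarrow> (real^'n \<Rightarrow> real) set" where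
  "E_roumieu MM U = {f. \<exists>D. E_roumieu_family MM U D \<and> (\<forall>x\<in>U. D (\<lambda>_. 0) x = f x)}"

definition E_beurling :: "(real \<Rightarrow> nat \<Rightarrow> real) \<Rightarrow> (real^'n::finite) set \<Rightarrow> (real^'n \<Rightarrow> real) set" where
  "E_beurling MM U = {f. \<exists>D. E_beurling_family MM U D \<and> (\<forall>x\<in>U. D (\<lambda>_. 0) x = f x)}"

text \<open>Images j^infty(E^{0,r}_{[M]}) of germs at 0: jets (d^alpha f(0)/|alpha|!) of functions
  of class [M] on some open neighbourhood of 0.\<close>
definition jet_roumieu :: "(real \<Rightarrow> nat \<Rightarrow> real) \<Rightarrow> (('n::finite \<Rightarrow> nat) \<Rightarrow> real) set" where
  "jet_roumieu MM = {b. \<exists>U D. open U \<and> (0::real^'n) \<in> U \<and> E_roumieu_family MM U D \<and>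
       b = (\<lambda>\<alpha>. D \<alpha> 0 / fact (mlen \<alpha>))}"

definition jet_beurling :: "(real \<Rightarrow> nat \<Rightarrow> real) \<Rightarrow> (('n::finite \<Rightarrow> nat) \<Rightarrow> real) set" where
  "jet_beurling MM = {b. \<exists>U D. open U \<and> (0::real^'n) \<in> U \<and> E_beurling_family MM U D \<and>
       b = (\<lambda>\<alpha>. D \<alpha> 0 / fact (mlen \<alpha>))}"

definition seq_norm_finite :: "(nat \<Rightarrow> real) \<Rightarrow> real \<Rightarrow> (('n::finite \<Rightarrow> nat) \<Rightarrow> real) \<Rightarrow> bool" where
  "seq_norm_finite N h b \<longleftrightarrow>
     (\<exists>C. \<forall>\<alpha>. \<bar>b \<alpha>\<bar> \<le> C * h ^ mlen \<alpha> * (N (mlen \<alpha>) / fact (mlen \<alpha>)))"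

definition Lambda_roumieu :: "(real \<Rightarrow> nat \<Rightarrow> real) \<Rightarrow> (('n::finite \<Rightarrow> nat) \<Rightarrow> real) set" where
  "Lambda_roumieu NN = {b. \<exists>l>0. \<exists>h>0. seq_norm_finite (NN l) h b}"

definition Lambda_beurling :: "(real \<Rightarrow> nat \<Rightarrow> real) \<Rightarrow> (('n::finite \<Rightarrow> nat) \<Rightarrow> real) set" where
  "Lambda_beurling NN = {b. \<forall>l>0. \<forall>h>0. seq_norm_finite (NN l) h b}"

text \<open>L is lineable: L \<union> {0} contains an infinite-dimensional real vector subspace of the
  space of real functions on the index set (pointwise operations). Infinite dimension is
  expressed by containing an infinite linearly independent sequence.\<close>
definition fun_subspace :: "('a \<Rightarrow> real) set \<Rightarrow> bool" where
  "fun_subspace V \<longleftrightarrow> (\<lambda>_. 0) \<in> V \<and>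
     (\<forall>u\<in>V. \<forall>w\<in>V. (\<lambda>x. u x + w x) \<in> V) \<and>
     (\<forall>c::real. \<forall>u\<in>V. (\<lambda>x. c * u x) \<in> V)"

definition lin_indep_seq :: "(nat \<Rightarrow> 'a \<Rightarrow> real) \<Rightarrow> bool" where
  "lin_indep_seq v \<longleftrightarrow>
     (\<forall>n c. (\<lambda>x. \<Sum>i<n. c i * v i x) = (\<lambda>_. 0) \<longrightarrow> (\<forall>i<n. c i = (0::real)))"

definition lineable :: "('a \<Rightarrow> real) set \<Rightarrow> bool" where
  "lineable L \<longleftrightarrow> (\<exists>V. fun_subspace V \<and> V \<subseteq> L \<union> {(\<lambda>_. 0)} \<and>
     (\<exists>v. (\<forall>n. v n \<in> V) \<and> lin_indep_seq v))"

end

theory Submission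
  imports Defs "HOL-Computational_Algebra.Polynomial"
begin

text \<open>
  It suffices to look at jets carried by one coordinate axis. There the key fact is a one-sided
  form of Bang's proof of the Denjoy--Carleman theorem: if \<open>f\<close> lies in a quasianalytic class on
  \<open>[0, T]\<close> and \<open>f\<^sup>(\<^sup>j\<^sup>)(0) \<ge> 0\<close> for all \<open>j\<close>, then every \<open>f\<^sup>(\<^sup>j\<^sup>)\<close> is nonnegative on \<open>[0, T]\<close>. By Taylor's
  formula \<open>f\<^sup>(\<^sup>j\<^sup>)(0) T\<^sup>j / j! \<le> f(T)\<close>, so the jet of \<open>f\<close> grows at most geometrically.
  Hence a nonnegative sequence \<open>a\<close> that is small enough for the sequence space of \<open>N\<close>, but with
  \<open>a\<^sub>k\<^sup>1\<^sup>/\<^sup>k\<close> unbounded, is not a jet, and the same is true of \<open>p(k) a\<^sub>k\<close> for every nonzero real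
  polynomial \<open>p\<close>, because \<open>p\<close> is eventually of constant sign and bounded away from zero.
\<close>

section \<open>Quasianalytic functions with nonnegative jet\<close>

text \<open>Descending induction on \<open>j\<close>. For \<open>j > n\<close> the global bound is
  already enough, since \<open>b \<ge> exp (- Suc n)\<close> gives
  \<open>exp j * M j * b \<ge> M j\<close>. For \<open>j \<le> n\<close> the exponential acts as a
  barrier: its rate, \<open>e\<close> times the ratio at \<open>n\<close>, dominates
  \<open>e\<close> times the ratio at \<open>j\<close>, so the lower bound on
  \<open>F (Suc j)\<close> stops \<open>F j\<close> from dropping below it. Only lower bounds enter,
  which is what makes the argument one-sided.\<close>

lemma lower_bound_propagation:
  fixes F :: "nat \<Rightarrow> real \<Rightarrow> real" and M :: "nat \<Rightarrow> real"
  assumes deriv: "\<And>j x. 0 \<le> x \<Longrightarrow> x \<le> T \<Longrightarrow> (F j has_real_derivative F (Suc j) x) (at x)"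
    and bound: "\<And>j x. 0 \<le> x \<Longrightarrow> x \<le> T \<Longrightarrow> - M j \<le> F j x"
    and pos: "\<And>j. 0 < M j"
    and ratio: "incseq (\<lambda>n. M (Suc n) / M n)"
    and y: "0 \<le> y" "\<And>j. - (exp (real j) * M j * b) \<le> F j y"
    and b: "exp (- real (Suc n)) \<le> b"
    and x: "y \<le> x" "x \<le> T"
  shows "- (exp (real j) * M j * (b * exp (exp 1 * (M (Suc n) / M n) * (x - y)))) \<le> F j x"
  using x
\<comment> \<open>Truncated subtraction puts every order \<open>j > n\<close> into the base case.
  The point \<open>x\<close> stays arbitrary because the bound for \<open>Suc j\<close> is needed on
  all of \<open>[y, x]\<close>.\<close>
proof (induction "Suc n - j" arbitrary: j x)
  case 0
  then have j: "Suc n \<le> j" by simp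
  define c where "c = exp 1 * (M (Suc n) / M n)"
  have c: "0 \<le> c" using pos[of n] pos[of "Suc n"] by (simp add: c_def)
  have b0: "0 < b" using b exp_gt_zero less_le_trans by blast
  have "exp (- real j) \<le> exp (- real (Suc n))" using j by simp
  also have "\<dots> \<le> b * 1" using b by simp
  also have "\<dots> \<le> b * exp (c * (x - y))"
    using c 0 b0 by (intro mult_left_mono) auto
  finally have "exp (real j) * M j * exp (- real j) \<le> exp (real j) * M j * (b * exp (c * (x - y)))"
    using pos[of j] by (intro mult_left_mono) auto
  moreover have "exp (real j) * M j * exp (- real j) = M j"
    by (simp add: exp_minus field_simps)
  moreover have "- M j \<le> F j x" using bound 0 y by simp
  ultimately show ?case by (simp add: c_def)
next
  case (Suc m)
  then have j: "j \<le> n" by simp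
  define c where "c = exp 1 * (M (Suc n) / M n)"
  define G where "G s = exp (real j) * M j * (b * exp (c * (s - y)))" for s
  have b0: "0 < b" using b exp_gt_zero less_le_trans by blast
  have "M (Suc j) / M j \<le> M (Suc n) / M n" using incseqD[OF ratio j] .
  then have r: "exp 1 * M (Suc j) \<le> c * M j"
    using mult_left_mono[of "M (Suc j) / M j" "M (Suc n) / M n" "exp 1 * M j"] pos[of j]
    by (simp add: c_def mult_ac)
  have "F j y + G y \<le> F j x + G x"
  proof (rule DERIV_nonneg_imp_nondecreasing[where f = "\<lambda>s. F j s + G s"])
    show "y \<le> x" by fact
    fix s assume s: "y \<le> s" "s \<le> x"
    have "(G has_real_derivative c * G s) (at s)"
      unfolding G_def by (auto intro!: derivative_eq_intros)
    then have d: "((\<lambda>s. F j s + G s) has_real_derivative F (Suc j) s + c * G s) (at s)"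
      using deriv[of s j] s y Suc.prems by (intro DERIV_add) auto
    have "m = Suc n - Suc j" using Suc.hyps(2) by simp
    then have "- (exp (real (Suc j)) * M (Suc j) * (b * exp (c * (s - y)))) \<le> F (Suc j) s"
      unfolding c_def using s Suc.prems by (intro Suc.hyps(1)) auto
    \<comment> \<open>The weight \<open>exp j\<close> costs one factor \<open>e\<close> when passing
      from \<open>j\<close> to \<open>Suc j\<close>; \<open>c\<close> contains exactly this
      factor.\<close>
    moreover have "exp (real (Suc j)) * M (Suc j) * (b * exp (c * (s - y))) \<le> c * G s"
    proof -
      have "(exp 1 * M (Suc j)) * (exp (real j) * (b * exp (c * (s - y))))
        \<le> (c * M j) * (exp (real j) * (b * exp (c * (s - y))))"
        using r b0 by (intro mult_right_mono) auto
      then show ?thesis by (simp add: G_def exp_add mult_ac)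
    qed
    ultimately show "\<exists>D. ((\<lambda>s. F j s + G s) has_real_derivative D) (at s) \<and> 0 \<le> D"
      using d by force
  qed
  moreover have "0 \<le> F j y + G y" using y(2)[of j] by (simp add: G_def)
  ultimately show ?case by (simp add: G_def c_def)
qed

text \<open>The lower bound starts at level \<open>exp (- K)\<close> at the origin and needs at least the distance
  \<open>M n / (e * M (Suc n))\<close> to climb from \<open>exp (- Suc n)\<close> to \<open>exp (- n)\<close>.\<close>

lemma lower_bound_level:
  fixes F :: "nat \<Rightarrow> real \<Rightarrow> real" and M :: "nat \<Rightarrow> real"
  assumes deriv: "\<And>j x. 0 \<le> x \<Longrightarrow> x \<le> T \<Longrightarrow> (F j has_real_derivative F (Suc j) x) (at x)"
    and bound: "\<And>j x. 0 \<le> x \<Longrightarrow> x \<le> T \<Longrightarrow> - M j \<le> F j x"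
    and pos: "\<And>j. 0 < M j"
    and ratio: "incseq (\<lambda>n. M (Suc n) / M n)"
    and F0: "\<And>j. 0 \<le> F j 0"
    and N: "N \<le> K"
    and x: "0 \<le> x" "x \<le> T" "x \<le> (\<Sum>n=N..<K. M n / M (Suc n)) / exp 1"
  shows "- (exp (real j) * M j * exp (- real N)) \<le> F j x"
  using N x
proof (induction N arbitrary: j x rule: inc_induct)
  case base
  then have "x = 0" by simp
  moreover have "0 \<le> exp (real j) * M j * exp (- real K)" using pos[of j] by simp
  ultimately show ?case using order_trans[OF _ F0[of j]] by simp
next
  case (step n)
  define S where "S = (\<Sum>i=Suc n..<K. M i / M (Suc i)) / exp 1"
  \<comment> \<open>Level \<open>Suc n\<close> is known up to \<open>S\<close>; propagation covers
    the rest, of length at most \<open>M n / (e * M (Suc n))\<close>, so the exponent is at most 1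
    and one factor \<open>e\<close> is lost.\<close>
  define y where "y = min x S"
  have S: "0 \<le> S" unfolding S_def using pos by (intro divide_nonneg_nonneg sum_nonneg) (auto intro: less_imp_le)
  have y: "0 \<le> y" "y \<le> x" "y \<le> S" using S step.prems by (auto simp: y_def)
  have A: "- (exp (real i) * M i * exp (- real (Suc n))) \<le> F i y" for i
    using step.IH[of y i] y step.prems unfolding S_def by linarith
  have B: "- (exp (real j) * M j * (exp (- real (Suc n)) * exp (exp 1 * (M (Suc n) / M n) * (x - y)))) \<le> F j x"
    by (rule lower_bound_propagation[where T = T])
      (fact deriv bound pos ratio y A order_refl step.prems)+
  have "(\<Sum>i=n..<K. M i / M (Suc i)) / exp 1 = M n / M (Suc n) / exp 1 + S"
    unfolding S_def using step.hyps by (simp add: sum.atLeast_Suc_lessThan add_divide_distrib)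
  then have "x - y \<le> M n / M (Suc n) / exp 1"
    using step.prems pos[of n] pos[of "Suc n"] by (auto simp: y_def min_def)
  then have "exp 1 * (M (Suc n) / M n) * (x - y) \<le> 1"
    using pos[of n] pos[of "Suc n"] by (simp add: field_simps)
  then have "exp (- real (Suc n)) * exp (exp 1 * (M (Suc n) / M n) * (x - y)) \<le> exp (- real (Suc n)) * exp 1"
    by (intro mult_left_mono) auto
  also have "\<dots> = exp (- real n)" by (simp flip: exp_add)
  finally have "exp (real j) * M j * (exp (- real (Suc n)) * exp (exp 1 * (M (Suc n) / M n) * (x - y)))
     \<le> exp (real j) * M j * exp (- real n)"
    using pos[of j] by (intro mult_left_mono) auto
  then show ?case using B by linarith
qed

text \<open>Since the series of \<open>M n / M (Suc n)\<close> diverges, every tail of it is long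
  enough to reach \<open>x\<close>. Hence the bound of level \<open>N\<close> holds at
  \<open>x\<close> for every \<open>N\<close>, and \<open>N\<close> tends to infinity.\<close>

lemma quasianalytic_nonneg_derivatives:
  fixes F :: "nat \<Rightarrow> real \<Rightarrow> real" and M :: "nat \<Rightarrow> real"
  assumes deriv: "\<And>j x. 0 \<le> x \<Longrightarrow> x \<le> T \<Longrightarrow> (F j has_real_derivative F (Suc j) x) (at x)"
    and bound: "\<And>j x. 0 \<le> x \<Longrightarrow> x \<le> T \<Longrightarrow> - M j \<le> F j x"
    and pos: "\<And>j. 0 < M j"
    and ratio: "incseq (\<lambda>n. M (Suc n) / M n)"
    and qa: "quasianalytic M"
    and F0: "\<And>j. 0 \<le> F j 0"
    and x: "0 \<le> x" "x \<le> T"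
  shows "0 \<le> F j x"
proof -
  have level: "- (exp (real j) * M j * exp (- real N)) \<le> F j x" for N
  proof -
    define u where "u n = M (n + N) / M (Suc (n + N))" for n
    have "\<not> summable u"
      using qa summable_iff_shift[of "\<lambda>n. M n / M (Suc n)" N]
      unfolding u_def quasianalytic_def by simp
    moreover have "0 \<le> u n" for n using pos by (simp add: u_def less_imp_le)
    ultimately have "\<not> (\<forall>n. sum u {..<n} \<le> x * exp 1)"
      using bounded_imp_summable[of u "x * exp 1"] by (metis lessThan_Suc_atMost)
    then obtain n where "x * exp 1 < sum u {..<n}" by (auto simp: not_le)
    also have "sum u {..<n} = (\<Sum>i=N..<n+N. M i / M (Suc i))"
      using sum.shift_bounds_nat_ivl[of "\<lambda>i. M i / M (Suc i)" 0 N n]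
      by (simp add: u_def lessThan_atLeast0 add.commute)
    finally have "x \<le> (\<Sum>i=N..<n+N. M i / M (Suc i)) / exp 1"
      by (simp add: field_simps)
    note x' = this
    show ?thesis
      by (rule lower_bound_level[where T = T and K = "n + N"])
        (fact deriv bound pos ratio F0 x x' le_add2)+
  qed
  have "(\<lambda>N. exp (- real N)) \<longlonglongrightarrow> 0"
    by (intro filterlim_compose[OF exp_at_bot] filterlim_compose[OF filterlim_uminus_at_bot_at_top]
        filterlim_real_sequentially)
  then have "(\<lambda>N. - (exp (real j) * M j * exp (- real N))) \<longlonglongrightarrow> - (exp (real j) * M j * 0)"
    by (intro tendsto_intros)
  then show ?thesis
    using LIMSEQ_le_const2[of _ 0 "F j x"] level by auto
qed

text \<open>In Taylor's formula at 0 all terms and the remainder are nonnegative, so each single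
  term is at most the value at \<open>T\<close>.\<close>

lemma quasianalytic_nonneg_jet_bound:
  fixes F :: "nat \<Rightarrow> real \<Rightarrow> real" and M :: "nat \<Rightarrow> real"
  assumes T: "0 < T"
    and deriv: "\<And>j x. 0 \<le> x \<Longrightarrow> x \<le> T \<Longrightarrow> (F j has_real_derivative F (Suc j) x) (at x)"
    and bound: "\<And>j x. 0 \<le> x \<Longrightarrow> x \<le> T \<Longrightarrow> - M j \<le> F j x"
    and pos: "\<And>j. 0 < M j"
    and ratio: "incseq (\<lambda>n. M (Suc n) / M n)"
    and qa: "quasianalytic M"
    and F0: "\<And>j. 0 \<le> F j 0"
  shows "F n 0 / fact n * T ^ n \<le> F 0 T"
proof -
  have nonneg: "0 \<le> F j x" if "0 \<le> x" "x \<le> T" for j x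
    by (rule quasianalytic_nonneg_derivatives[where T = T and M = M])
      (fact deriv bound pos ratio qa F0 that)+
  obtain t where t: "0 < t" "t < T"
    "F 0 T = (\<Sum>m<Suc n. F m 0 / fact m * T ^ m) + F (Suc n) t / fact (Suc n) * T ^ Suc n"
    using Maclaurin[of T "Suc n" F "F 0"] T deriv by blast
  have "0 \<le> (\<Sum>m<n. F m 0 / fact m * T ^ m)"
    using F0 T by (intro sum_nonneg) auto
  moreover have "0 \<le> F (Suc n) t / fact (Suc n) * T ^ Suc n"
    using nonneg[of t "Suc n"] t T by (intro mult_nonneg_nonneg divide_nonneg_nonneg) auto
  ultimately show ?thesis using t(3) by simp
qed

text \<open>The previous bound is applied to the derivative of order \<open>m\<close>. Shifting
  indices preserves all hypotheses on \<open>M\<close>, and replacing \<open>fact (j - m)\<close> by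
  \<open>fact j\<close> only helps; the factor \<open>T ^ m\<close> goes into the constant.\<close>

lemma quasianalytic_eventually_nonneg_jet_bound:
  fixes F :: "nat \<Rightarrow> real \<Rightarrow> real" and M :: "nat \<Rightarrow> real"
  assumes T: "0 < T"
    and deriv: "\<And>j x. 0 \<le> x \<Longrightarrow> x \<le> T \<Longrightarrow> (F j has_real_derivative F (Suc j) x) (at x)"
    and bound: "\<And>j x. 0 \<le> x \<Longrightarrow> x \<le> T \<Longrightarrow> - M j \<le> F j x"
    and pos: "\<And>j. 0 < M j"
    and ratio: "incseq (\<lambda>n. M (Suc n) / M n)"
    and qa: "quasianalytic M"
    and F0: "\<And>j. m \<le> j \<Longrightarrow> 0 \<le> F j 0"
  obtains C where "\<And>j. m \<le> j \<Longrightarrow> F j 0 / fact j * T ^ j \<le> C"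
proof
  fix j assume j: "m \<le> j"
  have "F (j - m + m) 0 / fact (j - m) * T ^ (j - m) \<le> F (0 + m) T"
  proof (rule quasianalytic_nonneg_jet_bound[where F = "\<lambda>n. F (n + m)" and M = "\<lambda>n. M (n + m)"])
    show "incseq (\<lambda>n. M (Suc n + m) / M (n + m))"
      using ratio by (auto simp: incseq_def)
    show "quasianalytic (\<lambda>n. M (n + m))"
      using qa summable_iff_shift[of "\<lambda>n. M n / M (Suc n)" m] by (simp add: quasianalytic_def)
  qed (use T deriv bound pos F0 in auto)
  then have "F j 0 / fact (j - m) * T ^ (j - m) \<le> F m T" using j by simp
  moreover have "F j 0 / fact j \<le> F j 0 / fact (j - m)"
    using F0[OF j] by (intro divide_left_mono fact_mono) auto
  then have "F j 0 / fact j * T ^ (j - m) \<le> F j 0 / fact (j - m) * T ^ (j - m)"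
    using T by (intro mult_right_mono) auto
  ultimately have "F j 0 / fact j * T ^ (j - m) * T ^ m \<le> F m T * T ^ m"
    using T by (intro mult_right_mono) auto
  then show "F j 0 / fact j * T ^ j \<le> F m T * T ^ m"
    using j by (simp add: mult.assoc flip: power_add)
qed

section \<open>Jets along a coordinate axis\<close>

definition axis_multi_index :: "'n \<Rightarrow> nat \<Rightarrow> 'n \<Rightarrow> nat" where
  "axis_multi_index i k = (\<lambda>_. 0)(i := k)"

lemma mlen_axis_multi_index [simp]: "mlen (axis_multi_index i k :: 'n::finite \<Rightarrow> nat) = k"
proof -
  have "mlen (axis_multi_index i k) = (\<Sum>j\<in>UNIV. if j = i then k else 0)"
    unfolding mlen_def axis_multi_index_def by (intro sum.cong) auto
  then show ?thesis by simp
qed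

lemma weight_sequence_ratio:
  assumes "weight_sequence M"
  shows "incseq (\<lambda>n. M (Suc n) / M n)"
proof (rule incseq_SucI)
  fix n
  have pos: "0 < M n" "0 < M (Suc n)" using assms by (auto simp: weight_sequence_def)
  have "\<forall>p\<ge>1. (M p)\<^sup>2 \<le> M (p - 1) * M (p + 1)"
    using assms unfolding weight_sequence_def by blast
  from this[rule_format, of "Suc n"] have "(M (Suc n))\<^sup>2 \<le> M n * M (Suc (Suc n))" by simp
  then show "M (Suc n) / M n \<le> M (Suc (Suc n)) / M (Suc n)"
    using pos by (simp add: field_simps power2_eq_square)
qed

text \<open>A germ of the class is restricted to a short half-axis, where it becomes a one-variable
  function of a quasianalytic class. The factor \<open>c\<close> allows jets that are eventually of
  either sign.\<close>

lemma jet_roumieu_axis_bound: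
  fixes b :: "('n::finite \<Rightarrow> nat) \<Rightarrow> real"
  assumes MM: "weight_matrix MM" "quasianalytic_matrix MM"
    and b: "b \<in> jet_roumieu MM"
    and nonneg: "\<And>k. m \<le> k \<Longrightarrow> 0 \<le> c * b (axis_multi_index i k)"
  obtains T C where "0 < T" "\<And>k. m \<le> k \<Longrightarrow> c * b (axis_multi_index i k) * T ^ k \<le> C"
proof -
  from b obtain U D where U: "open U" "(0::real^'n) \<in> U" and ED: "E_roumieu_family MM U D"
    and bD: "b = (\<lambda>\<alpha>. D \<alpha> 0 / fact (mlen \<alpha>))"
    unfolding jet_roumieu_def by blast
  obtain e where e: "0 < e" "cball 0 e \<subseteq> U" using open_contains_cball U by blast
  define L where "L = cball (0::real^'n) e"
  have "compact L" "L \<subseteq> U" using e by (auto simp: L_def)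
  then obtain l h where lh: "0 < l" "0 < h" "norm_finite (MM l) L h D"
    using ED unfolding E_roumieu_family_def by blast
  then obtain C where C: "\<And>\<alpha> x. x \<in> L \<Longrightarrow> \<bar>D \<alpha> x\<bar> \<le> C * h ^ mlen \<alpha> * MM l (mlen \<alpha>)"
    unfolding norm_finite_def by blast
  have ws: "weight_sequence (MM l)" and qa: "quasianalytic (MM l)"
    using MM lh by (auto simp: weight_matrix_def quasianalytic_matrix_def)
  have Mpos: "0 < MM l p" for p using ws by (auto simp: weight_sequence_def)
  \<comment> \<open>The summands 1 keep the new weight \<open>M\<close> positive even if
    \<open>c\<close> or \<open>C\<close> vanishes. In the quotients of \<open>M\<close> the constant
    \<open>B\<close> cancels and \<open>h\<close> is a mere scaling, so monotone ratios and
    divergence carry over.\<close>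
  define B where "B = (\<bar>c\<bar> + 1) * (\<bar>C\<bar> + 1)"
  have B: "0 < B" by (auto simp: B_def intro!: mult_pos_pos)
  define M where "M p = B * h ^ p * MM l p" for p
  define F where "F p t = c * D (axis_multi_index i p) (t *\<^sub>R axis i 1)" for p t
  have inL: "t *\<^sub>R axis i (1::real) \<in> L" if "0 \<le> t" "t \<le> e" for t
    using that by (simp add: L_def)
  have ratio_eq: "M (Suc n) / M n = h * (MM l (Suc n) / MM l n)" for n
    using B lh Mpos[of n] by (simp add: M_def field_simps)
  have inv_eq: "M n / M (Suc n) = (1 / h) * (MM l n / MM l (Suc n))" for n
    using B lh Mpos[of "Suc n"] by (simp add: M_def field_simps)
  obtain C' where "\<And>j. m \<le> j \<Longrightarrow> F j 0 / fact j * e ^ j \<le> C'"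
  proof (rule quasianalytic_eventually_nonneg_jet_bound[of e F M m])
    show "0 < e" by fact
    fix j
    show "0 < M j" using B lh Mpos by (simp add: M_def)
    fix x :: real assume x: "0 \<le> x" "x \<le> e"
    have xU: "x *\<^sub>R axis i 1 \<in> U" using inL[OF x] \<open>L \<subseteq> U\<close> by blast
    \<comment> \<open>\<open>smooth_family\<close> gives partial derivatives as derivatives at
      \<open>t = 0\<close> of a translate; \<open>DERIV_shift\<close> then moves the base point to
      \<open>x\<close>.\<close>
    have "((\<lambda>t. D (axis_multi_index i j) (x *\<^sub>R axis i 1 + t *\<^sub>R axis i 1)) has_real_derivative
        D ((axis_multi_index i j)(i := Suc (axis_multi_index i j i))) (x *\<^sub>R axis i 1)) (at 0)"
      using ED xU unfolding E_roumieu_family_def smooth_family_def by blast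
    moreover have "(axis_multi_index i j)(i := Suc (axis_multi_index i j i)) = axis_multi_index i (Suc j)"
      by (auto simp: axis_multi_index_def)
    ultimately have "((\<lambda>t. D (axis_multi_index i j) ((t + x) *\<^sub>R axis i 1)) has_real_derivative
        D (axis_multi_index i (Suc j)) (x *\<^sub>R axis i 1)) (at 0)"
      by (simp add: algebra_simps)
    then have "((\<lambda>t. D (axis_multi_index i j) (t *\<^sub>R axis i 1)) has_real_derivative
        D (axis_multi_index i (Suc j)) (x *\<^sub>R axis i 1)) (at (0 + x))"
      by (subst DERIV_shift)
    then show "(F j has_real_derivative F (Suc j) x) (at x)"
      unfolding F_def by (intro DERIV_cmult) simp
    have P: "0 \<le> h ^ j * MM l j" using lh Mpos[of j] by simp
    have "\<bar>F j x\<bar> \<le> \<bar>c\<bar> * (C * h ^ j * MM l j)"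
      using C[OF inL[OF x], of "axis_multi_index i j"] by (simp add: F_def abs_mult mult_left_mono)
    also have "\<dots> = (\<bar>c\<bar> * C) * (h ^ j * MM l j)" by simp
    also have "\<dots> \<le> B * (h ^ j * MM l j)"
    proof (rule mult_right_mono[OF _ P])
      have "\<bar>c\<bar> * C \<le> \<bar>c\<bar> * \<bar>C\<bar>" by (intro mult_left_mono) auto
      also have "\<dots> \<le> B" unfolding B_def by (intro mult_mono) auto
      finally show "\<bar>c\<bar> * C \<le> B" .
    qed
    finally show "- M j \<le> F j x" by (simp add: M_def mult.assoc)
  next
    show "incseq (\<lambda>n. M (Suc n) / M n)"
      unfolding ratio_eq using weight_sequence_ratio[OF ws] lh(2)
      unfolding incseq_def by (intro allI impI mult_left_mono) auto
    show "quasianalytic M"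
      using qa lh(2) unfolding quasianalytic_def inv_eq by (subst summable_cmult_iff) simp
    fix j assume "m \<le> j"
    then show "0 \<le> F j 0"
      using mult_nonneg_nonneg[OF nonneg[of j], of "fact j"] by (simp add: F_def bD)
  qed blast
  moreover have "F j 0 / fact j = c * b (axis_multi_index i j)" for j
    by (simp add: F_def bD)
  ultimately show ?thesis by (intro that[OF e(1), of C']) simp
qed

section \<open>A small sequence of superexponential growth\<close>

lemma root_unbounded_frequently:
  fixes f :: "nat \<Rightarrow> real"
  assumes unb: "\<And>C. \<exists>k>0. root k (f k) > C"
    and C: "0 \<le> C"
  shows "\<exists>k>m. C ^ k < f k"
proof -
  \<comment> \<open>\<open>B\<close> dominates \<open>C\<close> and all roots up to index
    \<open>m\<close>, so a root above \<open>B\<close> occurs only beyond \<open>m\<close>.\<close>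
  define B where "B = C + (\<Sum>k\<le>m. \<bar>root k (f k)\<bar>)"
  have B: "C \<le> B" by (simp add: B_def sum_nonneg)
  obtain k where k: "0 < k" "B < root k (f k)" using unb by blast
  have "m < k"
  proof (rule ccontr)
    assume "\<not> m < k"
    then have "\<bar>root k (f k)\<bar> \<le> (\<Sum>k\<le>m. \<bar>root k (f k)\<bar>)"
      by (intro member_le_sum) auto
    then show False using k(2) C by (simp add: B_def)
  qed
  moreover have "C ^ k < root k (f k) ^ k"
    using k B C by (intro power_strict_mono) auto
  moreover have "root k (f k) ^ k = f k"
  proof -
    have "0 < root k (f k)" using k B C by linarith
    then show ?thesis using k(1) by simp
  qed
  ultimately show ?thesis by auto
qed

text \<open>A diagonal choice: \<open>a\<close> lives on a sparse set of indices
  \<open>\<kappa> j\<close>, with value \<open>Suc j ^ \<kappa> j\<close>, where the weight with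
  parameter \<open>1 / Suc j\<close> exceeds the square of this value. The parameters fall below
  every \<open>l\<close>, so one sequence serves all weights at once.\<close>

lemma small_sequence_of_superexponential_growth:
  fixes w :: "real \<Rightarrow> nat \<Rightarrow> real"
  assumes pos: "\<And>l k. 0 < l \<Longrightarrow> 0 < w l k"
    and mono: "\<And>l l' k. 0 < l \<Longrightarrow> l \<le> l' \<Longrightarrow> w l k \<le> w l' k"
    and unb: "\<And>l C. 0 < l \<Longrightarrow> \<exists>k>0. root k (w l k) > C"
  obtains a :: "nat \<Rightarrow> real" where
    "\<And>k. 0 \<le> a k"
    "\<And>l q. 0 < l \<Longrightarrow> 0 < q \<Longrightarrow> \<exists>C. \<forall>k. a k \<le> C * q ^ k * w l k"
    "\<And>R m. \<exists>k\<ge>m. R ^ k \<le> a k"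
proof -
  define e where "e j = 1 / real (Suc j)" for j
  have e: "0 < e j" for j by (simp add: e_def)
  \<comment> \<open>Of the two factors \<open>Suc j\<close>, one becomes the value of
    \<open>a\<close> and the other compensates an arbitrarily small \<open>q\<close>.\<close>
  have "\<exists>\<kappa>. \<forall>j. (real (Suc j) * real (Suc j)) ^ \<kappa> j < w (e j) (\<kappa> j) \<and> \<kappa> j < \<kappa> (Suc j)"
  proof (rule dependent_nat_choice)
    show "\<exists>k. (real (Suc 0) * real (Suc 0)) ^ k < w (e 0) k"
      using root_unbounded_frequently[OF unb[OF e], of 1] by auto
    show "\<exists>k. (real (Suc (Suc j)) * real (Suc (Suc j))) ^ k < w (e (Suc j)) k \<and> k' < k" for k' j
      using root_unbounded_frequently[OF unb[OF e], of "real (Suc (Suc j)) * real (Suc (Suc j))" k' "Suc j"]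
      by (auto simp del: of_nat_Suc)
  qed
  then obtain \<kappa> where \<kappa>: "\<And>j. (real (Suc j) * real (Suc j)) ^ \<kappa> j < w (e j) (\<kappa> j)"
    and "\<And>j. \<kappa> j < \<kappa> (Suc j)" by blast
  then have sm: "strict_mono \<kappa>" by (simp add: strict_mono_Suc_iff)
  define a where "a k = (if k \<in> range \<kappa> then real (Suc (inv \<kappa> k)) ^ k else 0)" for k
  have a_\<kappa>: "a (\<kappa> j) = real (Suc j) ^ \<kappa> j" for j
    using sm by (simp add: a_def strict_mono_imp_inj_on)
  show ?thesis
  proof
    show a0: "0 \<le> a k" for k by (simp add: a_def)
    show "\<exists>C. \<forall>k. a k \<le> C * q ^ k * w l k" if l: "0 < l" and q: "0 < q" for l q
    proof -
      \<comment> \<open>From \<open>j0\<close> on, both \<open>e j \<le> l\<close> and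
        \<open>q * Suc j \<ge> 1\<close> hold; the finitely many earlier values are absorbed by the
        sum in \<open>C\<close>.\<close>
      obtain j0 :: nat where j0: "1 / l + 1 / q < real j0" using reals_Archimedean2 by blast
      define C where "C = 1 + (\<Sum>j<j0. a (\<kappa> j) / (q ^ \<kappa> j * w l (\<kappa> j)))"
      have qw: "0 < q ^ k * w l k" for k using q pos[OF l] by simp
      have terms: "0 \<le> a k / (q ^ k * w l k)" for k
        using a0 qw by (simp add: less_imp_le)
      have C1: "1 \<le> C" unfolding C_def using terms by (simp add: sum_nonneg)
      have "a k \<le> C * (q ^ k * w l k)" for k
      proof (cases "k \<in> range \<kappa>")
        case False
        then show ?thesis using C1 qw[of k] by (simp add: a_def)
      next
        case True
        then obtain j where j: "k = \<kappa> j" by blast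
        show ?thesis
        proof (cases "j < j0")
          case True
          then have "a k / (q ^ k * w l k) \<le> (\<Sum>j<j0. a (\<kappa> j) / (q ^ \<kappa> j * w l (\<kappa> j)))"
            unfolding j using terms by (intro member_le_sum[of j]) auto
          then have "a k / (q ^ k * w l k) \<le> C" by (simp add: C_def)
          then show ?thesis using qw[of k] by (simp only: pos_divide_le_eq)
        next
          case False
          have "0 < 1 / l" "0 < 1 / q" using l q by auto
          then have "1 / l \<le> real (Suc j)" "1 / q \<le> real (Suc j)" using j0 False by linarith+
          then have el: "e j \<le> l" and eq: "1 \<le> q * real (Suc j)"
            using l q by (auto simp: e_def field_simps)
          have "real (Suc j) ^ k \<le> (q * real (Suc j) * real (Suc j)) ^ k"
            using eq by (intro power_mono) (auto simp: mult_le_cancel_right1)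
          also have "\<dots> = q ^ k * (real (Suc j) * real (Suc j)) ^ k"
            by (simp add: power_mult_distrib)
          also have "\<dots> \<le> q ^ k * w (e j) k"
            using \<kappa>[of j] q j by (intro mult_left_mono) auto
          also have "\<dots> \<le> q ^ k * w l k"
            using mono[OF e el] q by (intro mult_left_mono) auto
          also have "\<dots> \<le> C * (q ^ k * w l k)"
            using mult_right_mono[OF C1, of "q ^ k * w l k"] qw[of k] by simp
          finally show ?thesis using j a_\<kappa> by simp
        qed
      qed
      then show ?thesis by (auto simp: mult.assoc)
    qed
    show "\<exists>k\<ge>m. R ^ k \<le> a k" for R m
    proof -
      obtain j0 :: nat where j0: "\<bar>R\<bar> < real j0" using reals_Archimedean2 by blast
      define j where "j = max j0 m"
      have "m \<le> \<kappa> j" using strict_mono_imp_increasing[OF sm, of j] by (simp add: j_def)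
      moreover have "R ^ \<kappa> j \<le> \<bar>R\<bar> ^ \<kappa> j" using abs_ge_self[of "R ^ \<kappa> j"] by (simp only: power_abs)
      moreover have "\<bar>R\<bar> ^ \<kappa> j \<le> a (\<kappa> j)"
        unfolding a_\<kappa> using j0 by (intro power_mono) (auto simp: j_def)
      ultimately show ?thesis using order_trans by blast
    qed
  qed
qed

section \<open>Lineability\<close>

text \<open>Needed so that multiplication by a polynomial only changes the radius \<open>h\<close>
  in the sequence norms. Each Horner step multiplies by \<open>k \<le> 2 ^ k\<close>, hence doubles
  \<open>H\<close>.\<close>

lemma poly_le_geometric:
  fixes p :: "real poly"
  obtains C H where "0 < H" "0 \<le> C" "\<And>k. \<bar>poly p (real k)\<bar> \<le> C * H ^ k"
proof -
  have "\<exists>C\<ge>0. \<exists>H\<ge>1. \<forall>k. \<bar>poly p (real k)\<bar> \<le> C * H ^ k"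
  proof (induction p)
    case 0
    show ?case by (intro exI[of _ 0] exI[of _ 1] conjI) auto
  next
    case (pCons u p)
    then obtain C H where CH: "0 \<le> C" "1 \<le> H" "\<And>k. \<bar>poly p (real k)\<bar> \<le> C * H ^ k" by blast
    have "\<bar>poly (pCons u p) (real k)\<bar> \<le> (\<bar>u\<bar> + C) * (2 * H) ^ k" for k
    proof -
      have k2: "real k \<le> 2 ^ k" using of_nat_less_two_power[of k] by (simp add: less_imp_le)
      have "\<bar>poly (pCons u p) (real k)\<bar> \<le> \<bar>u\<bar> + real k * \<bar>poly p (real k)\<bar>"
        by (simp add: abs_mult abs_triangle_ineq order_trans[OF abs_triangle_ineq])
      also have "\<dots> \<le> \<bar>u\<bar> * (2 * H) ^ k + 2 ^ k * (C * H ^ k)"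
      proof (rule add_mono)
        have "1 \<le> (2 * H) ^ k" using CH by (intro one_le_power) simp
        then show "\<bar>u\<bar> \<le> \<bar>u\<bar> * (2 * H) ^ k" by (simp add: mult_le_cancel_left1)
        show "real k * \<bar>poly p (real k)\<bar> \<le> 2 ^ k * (C * H ^ k)"
          using CH k2 by (intro mult_mono) auto
      qed
      also have "\<dots> = (\<bar>u\<bar> + C) * (2 * H) ^ k" by (simp add: algebra_simps)
      finally show ?thesis .
    qed
    then show ?case using CH by (intro exI[of _ "\<bar>u\<bar> + C"] exI[of _ "2 * H"] conjI) auto
  qed
  then obtain C H where "0 \<le> C" "1 \<le> H" "\<And>k. \<bar>poly p (real k)\<bar> \<le> C * H ^ k" by blast
  then show ?thesis using that[of H C] by simp
qed

lemma lineable_mono: "lineable L \<Longrightarrow> L \<subseteq> L' \<Longrightarrow> lineable L'"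
  unfolding lineable_def by blast

lemma E_beurling_family_imp_roumieu: "E_beurling_family MM U D \<Longrightarrow> E_roumieu_family MM U D"
  unfolding E_beurling_family_def E_roumieu_family_def by (meson zero_less_one)

lemma jet_beurling_subset: "jet_beurling MM \<subseteq> jet_roumieu MM"
  unfolding jet_beurling_def jet_roumieu_def by (auto dest: E_beurling_family_imp_roumieu)

lemma Lambda_beurling_subset: "Lambda_beurling NN \<subseteq> Lambda_roumieu NN"
  unfolding Lambda_beurling_def Lambda_roumieu_def by (auto intro!: exI[of _ 1])

text \<open>The condition on \<open>\<alpha>\<close> says that all entries except the one at
  \<open>i\<close> vanish. Linearity in \<open>p\<close> makes the range over all polynomials the
  required subspace.\<close>

definition axis_multiple :: "'n \<Rightarrow> (nat \<Rightarrow> real) \<Rightarrow> real poly \<Rightarrow> ('n \<Rightarrow> nat) \<Rightarrow> real" where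
  "axis_multiple i a p \<alpha> = (if \<alpha> = axis_multi_index i (\<alpha> i) then poly p (real (\<alpha> i)) * a (\<alpha> i) else 0)"

lemma axis_multiple_on_axis [simp]:
  "axis_multiple i a p (axis_multi_index i k) = poly p (real k) * a k"
  by (simp add: axis_multiple_def axis_multi_index_def)

lemma axis_multiple_in_Lambda_beurling:
  fixes i :: "'n::finite"
  assumes NN: "weight_matrix NN"
    and a0: "\<And>k. 0 \<le> a k"
    and small: "\<And>l q. 0 < l \<Longrightarrow> 0 < q \<Longrightarrow> \<exists>C. \<forall>k. a k \<le> C * q ^ k * (NN l k / fact k)"
  shows "axis_multiple i a p \<in> Lambda_beurling NN"
  unfolding Lambda_beurling_def seq_norm_finite_def
proof (intro CollectI allI impI)
  fix l h :: real assume l: "0 < l" and h: "0 < h"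
  obtain C H where CH: "0 < H" "0 \<le> C" "\<And>k. \<bar>poly p (real k)\<bar> \<le> C * H ^ k"
    using poly_le_geometric[of p] by blast
  \<comment> \<open>The radius \<open>h / H\<close> leaves room for the growth \<open>H ^ k\<close>
    of the polynomial.\<close>
  obtain B where B: "\<And>k. a k \<le> B * (h / H) ^ k * (NN l k / fact k)"
    using small[of l "h / H"] l h CH by auto
  have Npos: "0 < NN l k" for k using NN l by (auto simp: weight_matrix_def weight_sequence_def)
  have "\<bar>poly p (real k) * a k\<bar> \<le> C * \<bar>B\<bar> * h ^ k * (NN l k / fact k)" for k
  proof -
    have "\<bar>poly p (real k) * a k\<bar> = \<bar>poly p (real k)\<bar> * a k" using a0 by (simp add: abs_mult)
    also have "\<dots> \<le> (C * H ^ k) * (\<bar>B\<bar> * (h / H) ^ k * (NN l k / fact k))"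
    proof (intro mult_mono CH)
      have "B * (h / H) ^ k * (NN l k / fact k) \<le> \<bar>B\<bar> * (h / H) ^ k * (NN l k / fact k)"
        using h CH Npos[of k] by (intro mult_right_mono) auto
      then show "a k \<le> \<bar>B\<bar> * (h / H) ^ k * (NN l k / fact k)" using B[of k] by linarith
    qed (use a0 CH in auto)
    also have "\<dots> = C * \<bar>B\<bar> * h ^ k * (NN l k / fact k)"
      using CH by (simp add: power_divide)
    finally show ?thesis .
  qed
  note le = this
  have "\<bar>axis_multiple i a p \<alpha>\<bar> \<le> C * \<bar>B\<bar> * h ^ mlen \<alpha> * (NN l (mlen \<alpha>) / fact (mlen \<alpha>))" for \<alpha>
  proof (cases "\<alpha> = axis_multi_index i (\<alpha> i)")
    case True
    then have "mlen \<alpha> = \<alpha> i" by (metis mlen_axis_multi_index)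
    then show ?thesis using le[of "\<alpha> i"] True by (simp add: axis_multiple_def)
  next
    case False
    then show ?thesis using CH h Npos[of "mlen \<alpha>"] by (simp add: axis_multiple_def)
  qed
  then show "\<exists>C. \<forall>\<alpha>. \<bar>axis_multiple i a p \<alpha>\<bar> \<le> C * h ^ mlen \<alpha> * (NN l (mlen \<alpha>) / fact (mlen \<alpha>))"
    by blast
qed

lemma axis_multiple_not_in_jet_roumieu:
  fixes i :: "'n::finite"
  assumes MM: "weight_matrix MM" "quasianalytic_matrix MM"
    and a0: "\<And>k. 0 \<le> a k"
    and large: "\<And>R m. \<exists>k\<ge>m. R ^ k \<le> a k"
    and p: "p \<noteq> 0"
  shows "axis_multiple i a p \<notin> jet_roumieu MM"
proof
  assume jet: "axis_multiple i a p \<in> jet_roumieu MM"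
  \<comment> \<open>With this sign, \<open>c * p\<close> is eventually at least its positive leading
    coefficient \<open>r\<close>, so the signed jet is eventually nonnegative and at least
    \<open>r * a k\<close>.\<close>
  define c where "c = sgn (lead_coeff p)"
  have lc: "0 < lead_coeff (smult c p)"
    using p by (simp add: c_def sgn_if) (metis leading_coeff_0_iff linorder_neqE_linordered_idom)
  define r where "r = lead_coeff (smult c p)"
  obtain x0 where x0: "\<And>x. x0 \<le> x \<Longrightarrow> r \<le> poly (smult c p) x"
    using poly_pinfty_gt_lc[OF lc] unfolding r_def by blast
  obtain m0 :: nat where m0: "x0 \<le> real m0" using real_arch_simple by blast
  have sign: "r * a k \<le> c * axis_multiple i a p (axis_multi_index i k)" if "m0 \<le> k" for k
    using mult_right_mono[OF x0[of "real k"] a0[of k]] that m0 by simp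
  obtain T C where T: "0 < T"
    and C: "\<And>k. m0 \<le> k \<Longrightarrow> c * axis_multiple i a p (axis_multi_index i k) * T ^ k \<le> C"
  proof (rule jet_roumieu_axis_bound[OF MM jet])
    fix k assume "m0 \<le> k"
    then show "0 \<le> c * axis_multiple i a p (axis_multi_index i k)"
      using sign[of k] a0[of k] lc unfolding r_def by (meson mult_nonneg_nonneg less_imp_le order_trans)
  qed blast
  obtain m1 :: nat where m1: "C / r < 2 ^ m1" using real_arch_pow[of 2 "C / r"] by auto
  \<comment> \<open>The base \<open>2 / T\<close> turns the bound by \<open>C\<close> into
    \<open>r * 2 ^ k \<le> C\<close>, which fails from \<open>m1\<close> on.\<close>
  obtain k where k: "max m0 m1 \<le> k" "(2 / T) ^ k \<le> a k" using large by blast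
  have r: "0 < r" using lc by (simp add: r_def)
  have "r * 2 ^ k = r * ((2 / T) ^ k * T ^ k)" using T by (simp add: power_divide)
  also have "\<dots> \<le> r * (a k * T ^ k)" using k(2) r T by (intro mult_left_mono mult_right_mono) auto
  also have "\<dots> \<le> c * axis_multiple i a p (axis_multi_index i k) * T ^ k"
    using mult_right_mono[OF sign[of k], of "T ^ k"] k(1) T by (simp add: mult.assoc)
  also have "\<dots> \<le> C" using C k(1) by simp
  finally have "2 ^ k \<le> C / r" using r by (simp add: field_simps)
  moreover have "(2::real) ^ m1 \<le> 2 ^ k" using k(1) by (intro power_increasing) auto
  ultimately show False using m1 by linarith
qed

lemma fun_subspace_axis_multiple: "fun_subspace (range (axis_multiple i a))"
  unfolding fun_subspace_def
proof (intro conjI ballI allI)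
  have "axis_multiple i a 0 = (\<lambda>_. 0)" by (auto simp: axis_multiple_def)
  then show "(\<lambda>_. 0) \<in> range (axis_multiple i a)" by (metis rangeI)
next
  fix u w assume "u \<in> range (axis_multiple i a)" "w \<in> range (axis_multiple i a)"
  then obtain p q where "u = axis_multiple i a p" "w = axis_multiple i a q" by blast
  then have "(\<lambda>x. u x + w x) = axis_multiple i a (p + q)"
    by (auto simp: axis_multiple_def algebra_simps)
  then show "(\<lambda>x. u x + w x) \<in> range (axis_multiple i a)" by simp
next
  fix c u assume "u \<in> range (axis_multiple i a)"
  then obtain p where "u = axis_multiple i a p" by blast
  then have "(\<lambda>x. c * u x) = axis_multiple i a (smult c p)"
    by (auto simp: axis_multiple_def algebra_simps)
  then show "(\<lambda>x. c * u x) \<in> range (axis_multiple i a)" by simp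
qed

text \<open>With \<open>R = 1\<close>, \<open>large\<close> makes \<open>a\<close> positive at
  arbitrarily large indices, so a linear relation would give a nonzero polynomial with infinitely
  many roots.\<close>

lemma lin_indep_axis_multiple:
  assumes large: "\<And>R m. \<exists>k\<ge>m. R ^ k \<le> a k"
  shows "lin_indep_seq (\<lambda>n. axis_multiple i a (monom 1 n))"
  unfolding lin_indep_seq_def
proof (intro allI impI)
  fix n j :: nat and c :: "nat \<Rightarrow> real"
  assume zero: "(\<lambda>\<alpha>. \<Sum>j<n. c j * axis_multiple i a (monom 1 j) \<alpha>) = (\<lambda>_. 0)" and j: "j < n"
  define p where "p = (\<Sum>j<n. monom (c j) j)"
  have "poly p (real k) * a k = 0" for k
    using fun_cong[OF zero, of "axis_multi_index i k"]
    by (simp add: p_def poly_sum poly_monom sum_distrib_right mult.assoc)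
  then have root: "poly p (real k) = 0" if "0 < a k" for k using that by (metis less_irrefl mult_eq_0_iff)
  have "p = 0"
  proof (rule ccontr)
    assume "p \<noteq> 0"
    then have "finite (real -` {x. poly p x = 0})"
      by (intro finite_vimageI poly_roots_finite) (auto simp: inj_on_def)
    then obtain m where m: "\<And>k. poly p (real k) = 0 \<Longrightarrow> k \<le> m"
      by (auto simp: finite_nat_set_iff_bounded_le)
    obtain k where k: "Suc m \<le> k" "1 ^ k \<le> a k" using large by blast
    then show False using m[of k] root[of k] by simp
  qed
  moreover have "coeff p j = c j" using j by (simp add: p_def coeff_sum)
  ultimately show "c j = 0" by simp
qed

text \<open>The strongest of the four combinations: the smaller sequence space minus the larger jet
  space, under the weaker growth condition. The others follow by monotonicity of
  lineability.\<close>

theorem lineable_Lambda_beurling_diff_jet_roumieu: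
  assumes MM: "weight_matrix MM" "quasianalytic_matrix MM" and NN: "weight_matrix NN"
    and unb: "\<And>l C. 0 < l \<Longrightarrow> \<exists>k>0. root k (NN l k / fact k) > C"
  shows "lineable (Lambda_beurling NN - (jet_roumieu MM :: (('n::finite \<Rightarrow> nat) \<Rightarrow> real) set))"
proof -
  have pos: "0 < NN l k / fact k" if "0 < l" for l k
    using NN that by (auto simp: weight_matrix_def weight_sequence_def)
  have mono: "NN l k / fact k \<le> NN l' k / fact k" if "0 < l" "l \<le> l'" for l l' k
    using NN that by (auto simp: weight_matrix_def intro!: divide_right_mono)
  obtain a :: "nat \<Rightarrow> real" where a0: "\<And>k. 0 \<le> a k"
    and small: "\<And>l q. 0 < l \<Longrightarrow> 0 < q \<Longrightarrow> \<exists>C. \<forall>k. a k \<le> C * q ^ k * (NN l k / fact k)"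
    and large: "\<And>R m. \<exists>k\<ge>m. R ^ k \<le> a k"
    by (rule small_sequence_of_superexponential_growth[of "\<lambda>l k. NN l k / fact k"])
      (erule pos | erule mono, assumption | erule unb | blast)+
  \<comment> \<open>Any axis serves; \<open>undefined\<close> merely names one.\<close>
  define i :: 'n where "i = undefined"
  have "axis_multiple i a p \<in> (Lambda_beurling NN - jet_roumieu MM) \<union> {\<lambda>_. 0}" for p
  proof (cases "p = 0")
    case True
    then have "axis_multiple i a p = (\<lambda>_. 0)" by (auto simp: axis_multiple_def)
    then show ?thesis by simp
  next
    case False
    have "axis_multiple i a p \<in> Lambda_beurling NN"
      by (rule axis_multiple_in_Lambda_beurling) (fact NN a0 small)+
    moreover have "axis_multiple i a p \<notin> jet_roumieu MM"
      by (rule axis_multiple_not_in_jet_roumieu) (fact MM a0 large False)+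
    ultimately show ?thesis by simp
  qed
  then have "range (axis_multiple i a) \<subseteq> (Lambda_beurling NN - jet_roumieu MM) \<union> {\<lambda>_. 0}"
    by blast
  moreover have "lin_indep_seq (\<lambda>n. axis_multiple i a (monom 1 n))"
    by (rule lin_indep_axis_multiple) (fact large)
  ultimately show ?thesis
    unfolding lineable_def
    by (intro exI[of _ "range (axis_multiple i a)"]
        exI[of _ "\<lambda>n. axis_multiple i a (monom 1 n)"] conjI fun_subspace_axis_multiple allI rangeI)
qed

theorem mainTheorem14:
  fixes MM NN :: "real \<Rightarrow> nat \<Rightarrow> real"
  assumes "weight_matrix MM" and "quasianalytic_matrix MM"
    and "weight_matrix NN" and "quasianalytic_matrix NN"
  shows
    "((\<forall>l>0. \<forall>C::real. \<exists>k>0. root k (NN l k / fact k) > C) \<longrightarrow>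
        lineable (Lambda_roumieu NN - (jet_roumieu MM :: (('n::finite \<Rightarrow> nat) \<Rightarrow> real) set)) \<and>
        lineable (Lambda_roumieu NN - (jet_beurling MM :: (('n \<Rightarrow> nat) \<Rightarrow> real) set)))
     \<and>
     ((\<forall>l>0. filterlim (\<lambda>k. root k (NN l k / fact k)) at_top at_top) \<longrightarrow>
        lineable (Lambda_beurling NN - (jet_roumieu MM :: (('n \<Rightarrow> nat) \<Rightarrow> real) set)) \<and>
        lineable (Lambda_beurling NN - (jet_beurling MM :: (('n \<Rightarrow> nat) \<Rightarrow> real) set)))"
proof (intro conjI impI)
  note main = lineable_Lambda_beurling_diff_jet_roumieu[OF assms(1-3), where ?'n = 'n]
  have subs: "(jet_beurling MM :: (('n \<Rightarrow> nat) \<Rightarrow> real) set) \<subseteq> jet_roumieu MM"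
    "(Lambda_beurling NN :: (('n \<Rightarrow> nat) \<Rightarrow> real) set) \<subseteq> Lambda_roumieu NN"
    by (rule jet_beurling_subset, rule Lambda_beurling_subset)
  {
    assume "\<forall>l>0. \<forall>C::real. \<exists>k>0. root k (NN l k / fact k) > C"
    then have L: "lineable (Lambda_beurling NN - (jet_roumieu MM :: (('n \<Rightarrow> nat) \<Rightarrow> real) set))"
      using main by blast
    show "lineable (Lambda_roumieu NN - (jet_roumieu MM :: (('n \<Rightarrow> nat) \<Rightarrow> real) set))"
      by (rule lineable_mono[OF L]) (use subs in blast)
    show "lineable (Lambda_roumieu NN - (jet_beurling MM :: (('n \<Rightarrow> nat) \<Rightarrow> real) set))"
      by (rule lineable_mono[OF L]) (use subs in blast)
  next
    assume lim: "\<forall>l>0. filterlim (\<lambda>k. root k (NN l k / fact k)) at_top at_top"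
    have "\<exists>k>0. root k (NN l k / fact k) > C" if "0 < l" for l C
    proof -
      \<comment> \<open>A limit at infinity gives unboundedness along positive indices, so the
        Beurling hypothesis reduces to the Roumieu one.\<close>
      have "eventually (\<lambda>k. root k (NN l k / fact k) > C \<and> k > 0) at_top"
        using lim that by (intro eventually_conj eventually_gt_at_top)
          (auto simp: filterlim_at_top_dense)
      then show ?thesis by (auto simp: eventually_at_top_linorder)
    qed
    then show L: "lineable (Lambda_beurling NN - (jet_roumieu MM :: (('n \<Rightarrow> nat) \<Rightarrow> real) set))"
      using main by blast
    show "lineable (Lambda_beurling NN - (jet_beurling MM :: (('n \<Rightarrow> nat) \<Rightarrow> real) set))"
      by (rule lineable_mono[OF L]) (use subs in blast)
  }
qed

end
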